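(* Let $\Delta$ be a simplicial complex on the finite vertex set $V$, and let $W$ be a subset of $V$, with complement $\overline{W} = V \setminus W$. Let $\chi$ be an $s$-coloring of the restriction $\Delta|_W$, given by $W = W_1 \cup \dots \cup W_s$. Let $\Delta_\chi$ be the (partially whiskered) simplicial complex built from $\Delta$ and $\chi$. Then $\Delta_\chi$ is vertex decomposable if and only if $\mathrm{link}_\Delta(\mu)|_{\overline{W}}$ is vertex decomposable for every face $\mu$ of $\Delta$ such that $\mu \subseteq W$ (including $\mu=\emptyset$).
   Context: A finite simplicial complex $\Delta$ on a finite vertex set $V$ is a collection of subsets of $V$ (faces) such that $\sigma \in \Delta$ and $\tau \subseteq \sigma$ imply $\tau \in \Delta$; the empty set is always taken to be a face of $\Delta$. Facets are the maximal faces under inclusion. A simplex is a complex having exactly one facet; the complex $\{\emptyset\}$ counts as a simplex. For a face $\sigma \in \Delta$, the deletion is $\Delta \setminus \sigma = \{\tau \in \Delta : \sigma \not\subseteq \tau\}$ and the link is $\mathrm{link}_\Delta(\sigma) = \{\tau \in \Delta : \sigma \cap \tau = \emptyset,\ \sigma \cup \tau \in \Delta\}$. For $\{v\}\in\Delta$ one writes $\Delta\setminus v$ and $\mathrm{link}_\Delta(v)$ for $\Delta \setminus \{v\}$ and $\mathrm{link}_\Delta(\{v\})$. Vertex decomposable (non-pure sense), defined recursively: $\Delta$ is vertex decomposable if either $\Delta$ is a simplex, or there is a vertex $v$ (with $\{v\}\in\Delta$) such that $\Delta \setminus v$ and $\mathrm{link}_\Delta(v)$ are both vertex decomposable and have no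 facet in common. Restriction: for $U \subseteq V$ and a complex $\Gamma$ whose faces are subsets of $V$, $\Gamma|_U = \{\sigma \in \Gamma : \sigma \subseteq U\}$. An $s$-coloring of a simplicial complex with vertex set $W$ is a partition $W = W_1 \cup \dots \cup W_s$ into pairwise disjoint (possibly empty) sets such that $|F \cap W_j| \le 1$ for every facet $F$ and every $1 \le j \le s$. Construction of $\Delta_\chi$: given $\Delta$ on $V = \{x_1,\dots,x_n\}$, $W \subseteq V$, and an $s$-coloring $\chi$ of $\Delta|_W$ given by $W = W_1 \cup \dots \cup W_s$, let $y_1,\dots,y_s$ be new vertices. Then $\Delta_\chi$ is the simplicial complex on $\{x_1,\dots,x_n,y_1,\dots,y_s\}$ whose faces are the sets $\sigma \cup \tau$ with $\sigma \in \Delta$ and $\tau \subseteq \{y_1,\dots,y_s\}$ such that $\sigma \cap W_j = \emptyset$ for every $y_j \in \tau$. *)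

theory Defs
  imports Main "HOL-Library.Disjoint_Sets"
begin

(* Complexes are sets of faces.  The vertex set V is separate data: an element of V need not
   be a vertex of the complex, i.e. {v} need not be a face. *)

definition simplicial_complex :: "'a set \<Rightarrow> 'a set set \<Rightarrow> bool" where
  "simplicial_complex V \<Delta> \<longleftrightarrow>
     finite V \<and> \<Delta> \<subseteq> Pow V \<and> {} \<in> \<Delta> \<and> (\<forall>\<sigma>\<in>\<Delta>. \<forall>\<tau>. \<tau> \<subseteq> \<sigma> \<longrightarrow> \<tau> \<in> \<Delta>)"

definition facets :: "'a set set \<Rightarrow> 'a set set" where
  "facets \<Delta> = {F \<in> \<Delta>. \<forall>G\<in>\<Delta>. F \<subseteq> G \<longrightarrow> G = F}"

definition is_simplex :: "'a set set \<Rightarrow> bool" where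
  "is_simplex \<Delta> \<longleftrightarrow> (\<exists>!F. F \<in> facets \<Delta>)"

definition deletion :: "'a set set \<Rightarrow> 'a set \<Rightarrow> 'a set set" where
  "deletion \<Delta> \<sigma> = {\<tau> \<in> \<Delta>. \<not> \<sigma> \<subseteq> \<tau>}"

definition link :: "'a set set \<Rightarrow> 'a set \<Rightarrow> 'a set set" where
  "link \<Delta> \<sigma> = {\<tau> \<in> \<Delta>. \<sigma> \<inter> \<tau> = {} \<and> \<sigma> \<union> \<tau> \<in> \<Delta>}"

definition restriction :: "'a set set \<Rightarrow> 'a set \<Rightarrow> 'a set set" where
  "restriction \<Gamma> U = {\<sigma> \<in> \<Gamma>. \<sigma> \<subseteq> U}"

(* Non-pure sense; meant for finite simplicial complexes, on which the recursion terminates,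
   so that the least fixed point is the recursively defined notion. *)
inductive vertex_decomposable :: "'a set set \<Rightarrow> bool" where
  simplex: "is_simplex \<Delta> \<Longrightarrow> vertex_decomposable \<Delta>"
| shed: "\<lbrakk>{v} \<in> \<Delta>; vertex_decomposable (deletion \<Delta> {v}); vertex_decomposable (link \<Delta> {v});
          facets (deletion \<Delta> {v}) \<inter> facets (link \<Delta> {v}) = {}\<rbrakk>
         \<Longrightarrow> vertex_decomposable \<Delta>"

(* The classes are \<chi> 1, ..., \<chi> s; they may be empty, and other values of \<chi> are irrelevant. *)
definition coloring :: "nat \<Rightarrow> 'a set \<Rightarrow> 'a set set \<Rightarrow> (nat \<Rightarrow> 'a set) \<Rightarrow> bool" where
  "coloring s W \<Gamma> \<chi> \<longleftrightarrow>
     W = (\<Union>j\<in>{1..s}. \<chi> j) \<and> disjoint_family_on \<chi> {1..s} \<and>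
     (\<forall>F\<in>facets \<Gamma>. \<forall>j\<in>{1..s}. card (F \<inter> \<chi> j) \<le> 1)"

(* The old vertex x is encoded as Inl x and the new vertex y_j as Inr j, which makes the
   y_j distinct from each other and from all old vertices. *)
definition whiskered :: "'a set set \<Rightarrow> nat \<Rightarrow> (nat \<Rightarrow> 'a set) \<Rightarrow> ('a + nat) set set" where
  "whiskered \<Delta> s \<chi> =
     {Inl ` \<sigma> \<union> Inr ` \<tau> | \<sigma> \<tau>. \<sigma> \<in> \<Delta> \<and> \<tau> \<subseteq> {1..s} \<and> (\<forall>j\<in>\<tau>. \<sigma> \<inter> \<chi> j = {})}"

end

theory Submission
  imports Defs
begin

text \<open>If a vertex \<open>w \<in> W\<^sub>j\<close> of \<open>\<Delta>\<close> is present, it is a shedding vertex of the whiskered complex: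
  its deletion and link are whiskerings of the deletion and link of \<open>w\<close> in \<open>\<Delta>\<close>, the latter without
  the colour \<open>j\<close>, and every facet of the deletion contains \<open>y\<^sub>j\<close> or a vertex of \<open>W\<^sub>j\<close>, while no face
  of the link does. Once all vertices in \<open>W\<close> are used up, what remains is the join of a simplex with
  a complex on the complement of \<open>W\<close>. Conversely, links of vertex decomposable complexes are vertex
  decomposable, and the link of \<open>\<mu>\<close> restricted to the complement of \<open>W\<close> is the link of the face
  \<open>\<mu> \<union> {y\<^sub>j. \<mu> \<inter> W\<^sub>j = {}}\<close> of the whiskered complex.\<close>

section \<open>Complexes, their deletions and links, and facets\<close>

lemma simplicial_complexD:
  assumes "simplicial_complex V \<Delta>"
  shows "finite \<Delta>" "{} \<in> \<Delta>" "\<And>\<sigma> \<tau>. \<sigma> \<in> \<Delta> \<Longrightarrow> \<tau> \<subseteq> \<sigma> \<Longrightarrow> \<tau> \<in> \<Delta>" "\<And>\<sigma>. \<sigma> \<in> \<Delta> \<Longrightarrow> \<sigma> \<subseteq> V"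
  using assms finite_subset[of \<Delta> "Pow V"] unfolding simplicial_complex_def by auto

lemma simplicial_complex_deletion:
  assumes "simplicial_complex V \<Delta>" "\<sigma> \<noteq> {}"
  shows "simplicial_complex V (deletion \<Delta> \<sigma>)"
proof -
  have "\<tau>' \<in> deletion \<Delta> \<sigma>" if "\<tau> \<in> deletion \<Delta> \<sigma>" "\<tau>' \<subseteq> \<tau>" for \<tau> \<tau>'
    using that simplicial_complexD(3)[OF assms(1), of \<tau> \<tau>'] unfolding deletion_def by blast
  moreover have "deletion \<Delta> \<sigma> \<subseteq> Pow V" "{} \<in> deletion \<Delta> \<sigma>" "finite V"
    using assms unfolding simplicial_complex_def deletion_def by auto
  ultimately show ?thesis unfolding simplicial_complex_def by blast
qed

lemma simplicial_complex_link:
  assumes "simplicial_complex V \<Delta>" "\<sigma> \<in> \<Delta>"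
  shows "simplicial_complex V (link \<Delta> \<sigma>)"
proof -
  have "\<tau>' \<in> link \<Delta> \<sigma>" if "\<tau> \<in> link \<Delta> \<sigma>" "\<tau>' \<subseteq> \<tau>" for \<tau> \<tau>'
  proof -
    have "\<sigma> \<union> \<tau>' \<in> \<Delta>"
      using that simplicial_complexD(3)[OF assms(1), of "\<sigma> \<union> \<tau>" "\<sigma> \<union> \<tau>'"]
      unfolding link_def by blast
    then show ?thesis
      using that simplicial_complexD(3)[OF assms(1)] unfolding link_def by blast
  qed
  moreover have "link \<Delta> \<sigma> \<subseteq> Pow V" "{} \<in> link \<Delta> \<sigma>" "finite V"
    using assms unfolding simplicial_complex_def link_def by auto
  ultimately show ?thesis unfolding simplicial_complex_def by blast
qed

lemma facetsD:
  assumes "F \<in> facets \<Delta>"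
  shows "F \<in> \<Delta>" "\<And>G. G \<in> \<Delta> \<Longrightarrow> F \<subseteq> G \<Longrightarrow> G = F"
  using assms unfolding facets_def by auto

lemma exists_facet_above:
  assumes "finite \<Delta>" "\<sigma> \<in> \<Delta>"
  obtains F where "F \<in> facets \<Delta>" "\<sigma> \<subseteq> F"
proof -
  obtain F where F: "F \<in> \<Delta>" "\<sigma> \<subseteq> F" "\<forall>G\<in>\<Delta>. F \<subseteq> G \<longrightarrow> F = G"
    using finite_has_maximal2[OF assms] by (elim bexE conjE)
  then have "F \<in> facets \<Delta>" unfolding facets_def by auto
  with that F(2) show thesis by blast
qed

lemma facets_Pow: "facets (Pow F) = {F}"
  unfolding facets_def by blast

text \<open>By finiteness every face lies below some facet, so a unique facet contains all
  faces.\<close>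

lemma is_simplex_iff:
  assumes "simplicial_complex V \<Delta>"
  shows "is_simplex \<Delta> \<longleftrightarrow> (\<exists>F. \<Delta> = Pow F)"
proof
  assume "is_simplex \<Delta>"
  then obtain F where F: "F \<in> facets \<Delta>" and uniq: "\<And>G. G \<in> facets \<Delta> \<Longrightarrow> G = F"
    unfolding is_simplex_def by blast
  have "\<sigma> \<subseteq> F" if "\<sigma> \<in> \<Delta>" for \<sigma>
    using exists_facet_above[OF simplicial_complexD(1)[OF assms] that] uniq by metis
  moreover have "\<sigma> \<in> \<Delta>" if "\<sigma> \<subseteq> F" for \<sigma>
    using F that simplicial_complexD(3)[OF assms] unfolding facets_def by blast
  ultimately show "\<exists>F. \<Delta> = Pow F" by blast
next
  assume "\<exists>F. \<Delta> = Pow F"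
  then show "is_simplex \<Delta>" unfolding is_simplex_def using facets_Pow by auto
qed

lemma vertex_decomposable_Pow: "vertex_decomposable (Pow F)"
  by (intro vertex_decomposable.simplex) (simp add: is_simplex_def facets_Pow)

section \<open>Links inherit vertex decomposability\<close>

text \<open>A face \<open>H\<close> above \<open>\<sigma> \<union> G\<close> yields the face
  \<open>H - \<sigma>\<close> of the link above \<open>G\<close>, so maximality carries over. Hence
  two complexes without a common facet have links at \<open>\<sigma>\<close> without a common
  facet.\<close>

lemma union_mem_facets:
  assumes "simplicial_complex V \<Delta>" "G \<in> facets (link \<Delta> \<sigma>)"
  shows "\<sigma> \<union> G \<in> facets \<Delta>"
proof -
  have G: "\<sigma> \<inter> G = {}" "\<sigma> \<union> G \<in> \<Delta>"
    and max: "\<And>H. H \<in> link \<Delta> \<sigma> \<Longrightarrow> G \<subseteq> H \<Longrightarrow> H = G"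
    using assms(2) unfolding facets_def link_def by auto
  have "H = \<sigma> \<union> G" if H: "H \<in> \<Delta>" "\<sigma> \<union> G \<subseteq> H" for H
  proof -
    have "\<sigma> \<union> (H - \<sigma>) = H" using H by blast
    then have "H - \<sigma> \<in> link \<Delta> \<sigma>"
      using H simplicial_complexD(3)[OF assms(1) H(1), of "H - \<sigma>"] unfolding link_def by auto
    then have "H - \<sigma> = G" using max H G by blast
    then show ?thesis using H by blast
  qed
  then show ?thesis using G unfolding facets_def by blast
qed

lemma link_Pow: "\<sigma> \<subseteq> F \<Longrightarrow> link (Pow F) \<sigma> = Pow (F - \<sigma>)"
  unfolding link_def by blast

lemma link_link:
  assumes "simplicial_complex V \<Delta>" "\<sigma> \<inter> \<tau> = {}"
  shows "link (link \<Delta> \<sigma>) \<tau> = link \<Delta> (\<sigma> \<union> \<tau>)"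
proof -
  have "\<rho> \<in> \<Delta>" "\<tau> \<union> \<rho> \<in> \<Delta>" "\<sigma> \<union> \<rho> \<in> \<Delta>" if "\<sigma> \<union> (\<tau> \<union> \<rho>) \<in> \<Delta>" for \<rho>
    using simplicial_complexD(3)[OF assms(1) that, of \<rho>]
      simplicial_complexD(3)[OF assms(1) that, of "\<tau> \<union> \<rho>"]
      simplicial_complexD(3)[OF assms(1) that, of "\<sigma> \<union> \<rho>"] by auto
  then have "\<rho> \<in> link (link \<Delta> \<sigma>) \<tau> \<longleftrightarrow> \<rho> \<in> link \<Delta> (\<sigma> \<union> \<tau>)" for \<rho>
    unfolding link_def mem_Collect_eq Un_assoc Int_Un_distrib Int_Un_distrib2 assms(2) Un_empty
    by metis
  then show ?thesis by (rule set_eqI)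
qed

lemma link_deletion:
  assumes "v \<notin> \<sigma>"
  shows "link (deletion \<Delta> {v}) \<sigma> = deletion (link \<Delta> \<sigma>) {v}"
  using assms unfolding link_def deletion_def by auto

text \<open>Induction on the derivation. If the shedding vertex \<open>v\<close> lies in
  \<open>\<sigma>\<close>, the link of \<open>\<sigma>\<close> is a link inside
  \<open>link \<Delta> {v}\<close>. Otherwise \<open>v\<close> still sheds in
  \<open>link \<Delta> \<sigma>\<close>, provided it is a vertex there.\<close>

lemma vertex_decomposable_link:
  assumes "vertex_decomposable \<Delta>" "simplicial_complex V \<Delta>" "\<sigma> \<in> \<Delta>"
  shows "vertex_decomposable (link \<Delta> \<sigma>)"
  using assms
proof (induction arbitrary: \<sigma> rule: vertex_decomposable.induct)
  case (simplex \<Delta>)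
  then obtain F where "\<Delta> = Pow F" using is_simplex_iff by blast
  with simplex show ?case using link_Pow vertex_decomposable_Pow by (metis PowD)
next
  case (shed v \<Delta>)
  note cpx = shed.prems(1)
  have del: "simplicial_complex V (deletion \<Delta> {v})"
    and lk: "simplicial_complex V (link \<Delta> {v})"
    using simplicial_complex_deletion[OF cpx] simplicial_complex_link[OF cpx shed.hyps(1)] by auto
  show ?case
  proof (cases "v \<in> \<sigma>")
    case True
    then have eq: "{v} \<union> (\<sigma> - {v}) = \<sigma>" by blast
    then have "\<sigma> - {v} \<in> link \<Delta> {v}"
      using shed.prems(2) simplicial_complexD(3)[OF cpx, of \<sigma> "\<sigma> - {v}"]
      unfolding link_def by auto
    moreover have "link (link \<Delta> {v}) (\<sigma> - {v}) = link \<Delta> \<sigma>"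
      using link_link[OF cpx, of "{v}" "\<sigma> - {v}"] eq by simp
    ultimately show ?thesis using shed.IH(2)[OF lk] by metis
  next
    case v: False
    have VDdel: "vertex_decomposable (deletion (link \<Delta> \<sigma>) {v})"
      using shed.IH(1)[OF del, of \<sigma>] shed.prems(2) v link_deletion[OF v, of \<Delta>]
      unfolding deletion_def by auto
    show ?thesis
    proof (cases "insert v \<sigma> \<in> \<Delta>")
      case True
      have vlk: "{v} \<in> link \<Delta> \<sigma>" using True v shed.hyps(1) unfolding link_def by auto
      have \<sigma>lk: "\<sigma> \<in> link \<Delta> {v}" using True v shed.prems(2) unfolding link_def by auto
      have eq: "link (link \<Delta> \<sigma>) {v} = link (link \<Delta> {v}) \<sigma>"
        using link_link[OF cpx, of \<sigma> "{v}"] link_link[OF cpx, of "{v}" \<sigma>] v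
        by (simp add: Un_commute)
      \<comment> \<open>Deletion and link of \<open>v\<close> commute with the link of
        \<open>\<sigma>\<close>, so adding \<open>\<sigma>\<close> to a common facet would give a
        common facet of \<open>deletion \<Delta> {v}\<close> and
        \<open>link \<Delta> {v}\<close>.\<close>
      have "facets (deletion (link \<Delta> \<sigma>) {v}) \<inter> facets (link (link \<Delta> \<sigma>) {v}) = {}"
        using union_mem_facets[OF del, of _ \<sigma>] union_mem_facets[OF lk, of _ \<sigma>] shed.hyps(4)
        unfolding eq link_deletion[OF v, symmetric] by blast
      then show ?thesis
        using vertex_decomposable.shed[OF vlk VDdel] shed.IH(2)[OF lk \<sigma>lk] eq by metis
    next
      case False
      \<comment> \<open>Here \<open>v\<close> is not a vertex of the link of
        \<open>\<sigma>\<close>, so deleting it changes nothing.\<close>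
      have "deletion (link \<Delta> \<sigma>) {v} = link \<Delta> \<sigma>"
      proof -
        have "v \<notin> \<tau>" if "\<tau> \<in> link \<Delta> \<sigma>" for \<tau>
          using that False simplicial_complexD(3)[OF cpx, of "\<sigma> \<union> \<tau>" "insert v \<sigma>"]
          unfolding link_def by blast
        then show ?thesis unfolding deletion_def by blast
      qed
      with VDdel show ?thesis by simp
    qed
  qed
qed

section \<open>Renaming vertices along an injective map\<close>

lemma inj_image_mem_image_iff:
  assumes "inj f"
  shows "f ` \<sigma> \<in> (`) f ` \<Delta> \<longleftrightarrow> \<sigma> \<in> \<Delta>"
  unfolding image_iff[of "f ` \<sigma>"] inj_image_eq_iff[OF assms] by simp

lemma eq_imageI: "A \<subseteq> range g \<Longrightarrow> (\<And>x. g x \<in> A \<longleftrightarrow> x \<in> B) \<Longrightarrow> A = g ` B"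
  by auto

lemma facets_image:
  assumes "inj f"
  shows "facets ((`) f ` \<Delta>) = (`) f ` facets \<Delta>"
proof -
  have "f ` \<sigma> \<in> facets ((`) f ` \<Delta>) \<longleftrightarrow> \<sigma> \<in> facets \<Delta>" for \<sigma>
    unfolding facets_def mem_Collect_eq inj_image_mem_image_iff[OF assms] ball_simps
      inj_image_subset_iff[OF assms] inj_image_eq_iff[OF assms] ..
  moreover have "facets ((`) f ` \<Delta>) \<subseteq> range ((`) f)"
    using subset_trans[OF Collect_restrict image_mono[OF subset_UNIV]] unfolding facets_def by this
  ultimately show ?thesis by (intro eq_imageI)
qed

lemma deletion_image:
  assumes "inj f"
  shows "deletion ((`) f ` \<Delta>) (f ` \<sigma>) = (`) f ` deletion \<Delta> \<sigma>"
proof -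
  have "f ` \<tau> \<in> deletion ((`) f ` \<Delta>) (f ` \<sigma>) \<longleftrightarrow> \<tau> \<in> deletion \<Delta> \<sigma>" for \<tau>
    unfolding deletion_def mem_Collect_eq inj_image_mem_image_iff[OF assms]
      inj_image_subset_iff[OF assms] ..
  moreover have "deletion ((`) f ` \<Delta>) (f ` \<sigma>) \<subseteq> range ((`) f)"
    using subset_trans[OF Collect_restrict image_mono[OF subset_UNIV]] unfolding deletion_def by this
  ultimately show ?thesis by (intro eq_imageI)
qed

lemma link_image:
  assumes "inj f"
  shows "link ((`) f ` \<Delta>) (f ` \<sigma>) = (`) f ` link \<Delta> \<sigma>"
proof -
  have "f ` \<tau> \<in> link ((`) f ` \<Delta>) (f ` \<sigma>) \<longleftrightarrow> \<tau> \<in> link \<Delta> \<sigma>" for \<tau>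
    unfolding link_def mem_Collect_eq image_Int[OF assms, symmetric] image_Un[symmetric]
      inj_image_mem_image_iff[OF assms] image_is_empty ..
  moreover have "link ((`) f ` \<Delta>) (f ` \<sigma>) \<subseteq> range ((`) f)"
    using subset_trans[OF Collect_restrict image_mono[OF subset_UNIV]] unfolding link_def by this
  ultimately show ?thesis by (intro eq_imageI)
qed

text \<open>Facets, deletions and links commute with an injective renaming, so each shedding step
  pulls back. This brings complexes found inside the sum type back to the type of
  \<open>\<Delta>\<close>.\<close>

lemma vertex_decomposable_image_imp:
  assumes "inj f" "vertex_decomposable ((`) f ` \<Delta>)"
  shows "vertex_decomposable \<Delta>"
  using assms(2)
proof (induction "(`) f ` \<Delta>" arbitrary: \<Delta> rule: vertex_decomposable.induct)
  case simplex
  then obtain F where F: "(`) f ` facets \<Delta> = {F}"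
    unfolding is_simplex_def facets_image[OF assms(1)] by (metis is_singletonI' is_singletonE empty_iff)
  have "is_simplex \<Delta>"
    unfolding is_simplex_def
    using F inj_image_eq_iff[OF assms(1)] by (metis image_iff insertI1 singletonD)
  then show ?case by (rule vertex_decomposable.simplex)
next
  case (shed w)
  then obtain v where v: "{v} \<in> \<Delta>" and w: "{w} = f ` {v}"
  proof -
    obtain \<sigma> where \<sigma>: "\<sigma> \<in> \<Delta>" "{w} = f ` \<sigma>" using shed.hyps(1) by blast
    then obtain v where "v \<in> \<sigma>" "f v = w" by blast
    \<comment> \<open>Injectivity forces the face mapped onto the singleton \<open>{w}\<close> to be
      a singleton itself.\<close>
    with \<sigma> assms(1) have "\<sigma> = {v}" by (auto dest: injD)
    with \<sigma> that show thesis by blast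
  qed
  have "vertex_decomposable (deletion \<Delta> {v})" "vertex_decomposable (link \<Delta> {v})"
    using shed.hyps(3,5) deletion_image[OF assms(1)] link_image[OF assms(1)] w by metis+
  moreover have "facets (deletion \<Delta> {v}) \<inter> facets (link \<Delta> {v}) = {}"
    using shed.hyps(6)
    unfolding w deletion_image[OF assms(1)] link_image[OF assms(1)] facets_image[OF assms(1)] by blast
  ultimately show ?case using vertex_decomposable.shed[OF v] by blast
qed

section \<open>Whiskerings over an arbitrary index set\<close>

text \<open>The index set \<open>J\<close> replaces \<open>{1..s}\<close> because passing to the
  link of a coloured vertex removes its colour, which would destroy an initial segment.\<close>

definition whiskering :: "'a set set \<Rightarrow> 'b set \<Rightarrow> ('b \<Rightarrow> 'a set) \<Rightarrow> ('a + 'b) set set" where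
  "whiskering \<Delta> J \<chi> =
     {Inl ` \<sigma> \<union> Inr ` \<tau> | \<sigma> \<tau>. \<sigma> \<in> \<Delta> \<and> \<tau> \<subseteq> J \<and> (\<forall>j\<in>\<tau>. \<sigma> \<inter> \<chi> j = {})}"

lemma whiskered_eq: "whiskered \<Delta> s \<chi> = whiskering \<Delta> {1..s} \<chi>"
  unfolding whiskered_def whiskering_def by simp

lemma Inl_Un_Inr_subset_iff:
  "Inl ` \<sigma> \<union> Inr ` \<tau> \<subseteq> Inl ` \<sigma>' \<union> Inr ` \<tau>' \<longleftrightarrow> \<sigma> \<subseteq> \<sigma>' \<and> \<tau> \<subseteq> \<tau>'"
  by auto

lemma Inl_Un_Inr_eq_iff:
  "Inl ` \<sigma> \<union> Inr ` \<tau> = Inl ` \<sigma>' \<union> Inr ` \<tau>' \<longleftrightarrow> \<sigma> = \<sigma>' \<and> \<tau> = \<tau>'"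
  unfolding set_eq_subset[of "_ \<union> _"] Inl_Un_Inr_subset_iff by blast

lemma Inl_Un_Inr_mem_whiskering_iff:
  "Inl ` \<sigma> \<union> Inr ` \<tau> \<in> whiskering \<Delta> J \<chi> \<longleftrightarrow>
     \<sigma> \<in> \<Delta> \<and> \<tau> \<subseteq> J \<and> (\<forall>j\<in>\<tau>. \<sigma> \<inter> \<chi> j = {})"
  unfolding whiskering_def mem_Collect_eq Inl_Un_Inr_eq_iff by blast

lemma Inl_Un_Inr_exhaust:
  obtains \<sigma> \<tau> where "\<rho> = Inl ` \<sigma> \<union> Inr ` \<tau>"
proof
  show "\<rho> = Inl ` (Inl -` \<rho>) \<union> Inr ` (Inr -` \<rho>)"
    by (auto simp: image_iff) (metis sum.exhaust)
qed

text \<open>Every subset of a sum type splits into an \<open>Inl\<close> and an \<open>Inr\<close>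
  part, so it suffices to compare members of that shape.\<close>

lemma set_of_sum_sets_eqI:
  assumes "\<And>\<sigma> \<tau>. Inl ` \<sigma> \<union> Inr ` \<tau> \<in> A \<longleftrightarrow> Inl ` \<sigma> \<union> Inr ` \<tau> \<in> B"
  shows "A = B"
  by (metis Inl_Un_Inr_exhaust assms subsetI subset_antisym)

lemma Inl_Un_Inr_mem_deletion_iff:
  "Inl ` \<sigma> \<union> Inr ` \<tau> \<in> deletion \<Gamma> (Inl ` \<sigma>' \<union> Inr ` \<tau>') \<longleftrightarrow>
     Inl ` \<sigma> \<union> Inr ` \<tau> \<in> \<Gamma> \<and> \<not> (\<sigma>' \<subseteq> \<sigma> \<and> \<tau>' \<subseteq> \<tau>)"
  unfolding deletion_def mem_Collect_eq Inl_Un_Inr_subset_iff ..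

lemma Inl_Un_Inr_mem_link_iff:
  "Inl ` \<sigma> \<union> Inr ` \<tau> \<in> link \<Gamma> (Inl ` \<sigma>' \<union> Inr ` \<tau>') \<longleftrightarrow>
     Inl ` \<sigma> \<union> Inr ` \<tau> \<in> \<Gamma> \<and> \<sigma>' \<inter> \<sigma> = {} \<and> \<tau>' \<inter> \<tau> = {} \<and>
     Inl ` (\<sigma>' \<union> \<sigma>) \<union> Inr ` (\<tau>' \<union> \<tau>) \<in> \<Gamma>"
proof -
  have "(Inl ` \<sigma>' \<union> Inr ` \<tau>') \<union> (Inl ` \<sigma> \<union> Inr ` \<tau>) = Inl ` (\<sigma>' \<union> \<sigma>) \<union> Inr ` (\<tau>' \<union> \<tau>)"
    by blast
  then show ?thesis unfolding link_def by auto
qed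

lemma simplicial_complex_whiskering:
  assumes "simplicial_complex V \<Delta>" "finite J"
  shows "simplicial_complex (Inl ` V \<union> Inr ` J) (whiskering \<Delta> J \<chi>)"
proof -
  have "\<rho>' \<in> whiskering \<Delta> J \<chi>" if "\<rho> \<in> whiskering \<Delta> J \<chi>" "\<rho>' \<subseteq> \<rho>" for \<rho> \<rho>'
  proof -
    obtain \<sigma> \<tau> where 1: "\<rho> = Inl ` \<sigma> \<union> Inr ` \<tau>" by (rule Inl_Un_Inr_exhaust)
    obtain \<sigma>' \<tau>' where 2: "\<rho>' = Inl ` \<sigma>' \<union> Inr ` \<tau>'" by (rule Inl_Un_Inr_exhaust)
    show ?thesis
      using that simplicial_complexD(3)[OF assms(1), of \<sigma> \<sigma>']
      unfolding 1 2 Inl_Un_Inr_mem_whiskering_iff Inl_Un_Inr_subset_iff by blast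
  qed
  moreover have "whiskering \<Delta> J \<chi> \<subseteq> Pow (Inl ` V \<union> Inr ` J)"
    using simplicial_complexD(4)[OF assms(1)] unfolding whiskering_def by blast
  moreover have "{} \<in> whiskering \<Delta> J \<chi>"
    using Inl_Un_Inr_mem_whiskering_iff[of "{}" "{}" \<Delta> J \<chi>] simplicial_complexD(2)[OF assms(1)] by simp
  moreover have "finite (Inl ` V \<union> Inr ` J)"
    using assms unfolding simplicial_complex_def by simp
  ultimately show ?thesis unfolding simplicial_complex_def by blast
qed

lemma deletion_whiskering:
  "deletion (whiskering \<Delta> J \<chi>) {Inl v} = whiskering (deletion \<Delta> {v}) J \<chi>"
proof (rule set_of_sum_sets_eqI)
  fix \<sigma> :: "'a set" and \<tau> :: "'b set"
  show "Inl ` \<sigma> \<union> Inr ` \<tau> \<in> deletion (whiskering \<Delta> J \<chi>) {Inl v} \<longleftrightarrow>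
    Inl ` \<sigma> \<union> Inr ` \<tau> \<in> whiskering (deletion \<Delta> {v}) J \<chi>"
    using Inl_Un_Inr_mem_deletion_iff[of \<sigma> \<tau> "whiskering \<Delta> J \<chi>" "{v}" "{}"]
    unfolding Inl_Un_Inr_mem_whiskering_iff deletion_def by auto
qed

text \<open>Joining \<open>v\<close> to a face excludes exactly the new vertices \<open>y_j\<close>
  with \<open>v \<in> \<chi> j\<close> and puts no other condition on the new vertices.\<close>

lemma link_whiskering:
  "link (whiskering \<Delta> J \<chi>) {Inl v} = whiskering (link \<Delta> {v}) {j \<in> J. v \<notin> \<chi> j} \<chi>"
proof (rule set_of_sum_sets_eqI)
  fix \<sigma> :: "'a set" and \<tau> :: "'b set"
  show "Inl ` \<sigma> \<union> Inr ` \<tau> \<in> link (whiskering \<Delta> J \<chi>) {Inl v} \<longleftrightarrow>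
    Inl ` \<sigma> \<union> Inr ` \<tau> \<in> whiskering (link \<Delta> {v}) {j \<in> J. v \<notin> \<chi> j} \<chi>"
    using Inl_Un_Inr_mem_link_iff[of \<sigma> \<tau> "whiskering \<Delta> J \<chi>" "{v}" "{}"]
    unfolding Inl_Un_Inr_mem_whiskering_iff link_def by auto
qed

section \<open>Vertex decomposability of whiskerings\<close>

text \<open>With empty classes the two parts of a face are independent, so the old part can be
  enlarged while \<open>\<tau>\<close> is kept.\<close>

lemma facet_of_whiskering_empty:
  assumes "Inl ` \<sigma> \<union> Inr ` \<tau> \<in> facets (whiskering \<Delta> J (\<lambda>_. {}))"
  shows "\<sigma> \<in> facets \<Delta>"
proof -
  have mem: "\<sigma> \<in> \<Delta>" "\<tau> \<subseteq> J"
    using facetsD(1)[OF assms] unfolding Inl_Un_Inr_mem_whiskering_iff by auto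
  have "\<sigma>' = \<sigma>" if "\<sigma>' \<in> \<Delta>" "\<sigma> \<subseteq> \<sigma>'" for \<sigma>'
  proof -
    have "Inl ` \<sigma>' \<union> Inr ` \<tau> \<in> whiskering \<Delta> J (\<lambda>_. {})"
      using that mem unfolding Inl_Un_Inr_mem_whiskering_iff by simp
    then have "Inl ` \<sigma>' \<union> Inr ` \<tau> = Inl ` \<sigma> \<union> Inr ` \<tau>"
      using that(2) by (intro facetsD(2)[OF assms]) auto
    then show ?thesis unfolding Inl_Un_Inr_eq_iff by blast
  qed
  with mem show ?thesis unfolding facets_def by blast
qed

text \<open>With empty colour classes the whiskering is the join of \<open>\<Delta>\<close> with the full simplex on \<open>J\<close>.\<close>

lemma vertex_decomposable_whiskering_empty:
  assumes "vertex_decomposable \<Delta>" "simplicial_complex V \<Delta>"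
  shows "vertex_decomposable (whiskering \<Delta> J (\<lambda>_. {}))"
  using assms
proof (induction rule: vertex_decomposable.induct)
  case (simplex \<Delta>)
  then obtain F where "\<Delta> = Pow F" using is_simplex_iff by blast
  then have "whiskering \<Delta> J (\<lambda>_. {}) = Pow (Inl ` F \<union> Inr ` J)"
    by (intro set_of_sum_sets_eqI)
      (simp only: Inl_Un_Inr_mem_whiskering_iff Pow_iff Inl_Un_Inr_subset_iff, simp)
  then show ?case using vertex_decomposable_Pow by metis
next
  case (shed v \<Delta>)
  let ?X = "\<lambda>\<Gamma>. whiskering \<Gamma> J (\<lambda>_. {})"
  have del: "simplicial_complex V (deletion \<Delta> {v})"
    and lk: "simplicial_complex V (link \<Delta> {v})"
    using simplicial_complex_deletion simplicial_complex_link shed.prems shed.hyps(1) by blast+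
  have eqs: "deletion (?X \<Delta>) {Inl v} = ?X (deletion \<Delta> {v})" "link (?X \<Delta>) {Inl v} = ?X (link \<Delta> {v})"
    by (simp_all add: deletion_whiskering link_whiskering)
  have "{Inl v} \<in> ?X \<Delta>"
    using Inl_Un_Inr_mem_whiskering_iff[of "{v}" "{}" \<Delta> J "\<lambda>_. {}"] shed.hyps(1) by simp
  \<comment> \<open>The old part of a common facet would be a common facet of the deletion and link
    of \<open>v\<close> in \<open>\<Delta>\<close>.\<close>
  moreover have "facets (?X (deletion \<Delta> {v})) \<inter> facets (?X (link \<Delta> {v})) = {}"
    using facet_of_whiskering_empty[where J = J] shed.hyps(4)
    by (metis Inl_Un_Inr_exhaust disjoint_iff)
  ultimately show ?case
    using vertex_decomposable.shed[of "Inl v" "?X \<Delta>"] shed.IH(1)[OF del] shed.IH(2)[OF lk]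
    unfolding eqs by blast
qed

text \<open>Otherwise \<open>y_j\<close> could be added to the facet.\<close>

lemma facet_of_whiskering_meets:
  assumes "Inl ` \<sigma> \<union> Inr ` \<tau> \<in> facets (whiskering \<Delta> J \<chi>)" "j \<in> J"
  shows "j \<in> \<tau> \<or> \<sigma> \<inter> \<chi> j \<noteq> {}"
proof (rule ccontr)
  assume neg: "\<not> ?thesis"
  have "\<sigma> \<in> \<Delta> \<and> \<tau> \<subseteq> J \<and> (\<forall>k\<in>\<tau>. \<sigma> \<inter> \<chi> k = {})"
    using facetsD(1)[OF assms(1)] unfolding Inl_Un_Inr_mem_whiskering_iff .
  then have "Inl ` \<sigma> \<union> Inr ` insert j \<tau> \<in> whiskering \<Delta> J \<chi>"
    using neg assms(2) unfolding Inl_Un_Inr_mem_whiskering_iff by simp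
  then have "Inl ` \<sigma> \<union> Inr ` insert j \<tau> = Inl ` \<sigma> \<union> Inr ` \<tau>"
    by (intro facetsD(2)[OF assms(1)]) auto
  then show False using neg unfolding Inl_Un_Inr_eq_iff by blast
qed

text \<open>Induction on the number of faces, with \<open>V\<close> and \<open>\<chi>\<close> fixed
  while \<open>\<Delta>\<close> and \<open>J\<close> vary. The colouring condition is put on all
  faces rather than facets, so that it passes to subcomplexes at once.\<close>

lemma vertex_decomposable_whiskering:
  assumes "simplicial_complex V \<Delta>"
    and "disjoint_family_on \<chi> J"
    and "\<And>\<sigma> j x y. \<sigma> \<in> \<Delta> \<Longrightarrow> j \<in> J \<Longrightarrow> {x, y} \<subseteq> \<sigma> \<inter> \<chi> j \<Longrightarrow> x = y"
    and "\<And>\<mu>. \<mu> \<in> \<Delta> \<Longrightarrow> \<mu> \<subseteq> (\<Union>j\<in>J. \<chi> j) \<Longrightarrow>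
           vertex_decomposable (restriction (link \<Delta> \<mu>) (V - (\<Union>j\<in>J. \<chi> j)))"
  shows "vertex_decomposable (whiskering \<Delta> J \<chi>)"
  using assms
proof (induction "card \<Delta>" arbitrary: \<Delta> J rule: less_induct)
  case less
  note cpx = less.prems(1)
  let ?W = "\<Union>j\<in>J. \<chi> j"
  show ?case
  proof (cases "\<exists>w\<in>?W. {w} \<in> \<Delta>")
    case False
    have avoid: "\<sigma> \<inter> ?W = {}" if "\<sigma> \<in> \<Delta>" for \<sigma>
      using False simplicial_complexD(3)[OF cpx that, of "{_}"] by blast
    \<comment> \<open>No face meets a colour class, so the hypothesis at the empty face speaks of
      \<open>\<Delta>\<close> itself.\<close>
    then have "restriction (link \<Delta> {}) (V - ?W) = \<Delta>"
      unfolding restriction_def link_def by (auto dest: subsetD[OF simplicial_complexD(4)[OF cpx]])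
    then have "vertex_decomposable \<Delta>"
      using less.prems(4)[OF simplicial_complexD(2)[OF cpx]] by simp
    moreover have "whiskering \<Delta> J \<chi> = whiskering \<Delta> J (\<lambda>_. {})"
      using avoid unfolding whiskering_def by blast
    ultimately show ?thesis using vertex_decomposable_whiskering_empty cpx by metis
  next
    case True
    then obtain w j where w: "{w} \<in> \<Delta>" and j: "j \<in> J" "w \<in> \<chi> j" by blast
    let ?J = "{k \<in> J. w \<notin> \<chi> k}" and ?D = "deletion \<Delta> {w}" and ?L = "link \<Delta> {w}"
    \<comment> \<open>The classes are disjoint, so \<open>j\<close> is the only colour of
      \<open>w\<close>.\<close>
    have J: "?J = J - {j}"
      using less.prems(2) j unfolding disjoint_family_on_def by blast
    have del: "simplicial_complex V ?D" and lk: "simplicial_complex V ?L"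
      using simplicial_complex_deletion simplicial_complex_link cpx w by blast+
    \<comment> \<open>Both inclusions are strict because \<open>{w}\<close> is a face of
      \<open>\<Delta>\<close> only.\<close>
    have sub: "?D \<subset> \<Delta>" "?L \<subset> \<Delta>"
      using w unfolding deletion_def link_def by auto
    then have small: "card ?D < card \<Delta>" "card ?L < card \<Delta>"
      using psubset_card_mono simplicial_complexD(1)[OF cpx] by blast+
    \<comment> \<open>The face \<open>{w} \<union> \<sigma>\<close> already has \<open>w\<close> in
      the class \<open>\<chi> j\<close>.\<close>
    have Lj: "\<sigma> \<inter> \<chi> j = {}" if "\<sigma> \<in> ?L" for \<sigma>
    proof -
      have "w \<notin> \<sigma>" "{w} \<union> \<sigma> \<in> \<Delta>" using that unfolding link_def by auto
      then show ?thesis using less.prems(3)[of "{w} \<union> \<sigma>" j w] j by blast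
    qed

    have VDdel: "vertex_decomposable (deletion (whiskering \<Delta> J \<chi>) {Inl w})"
      unfolding deletion_whiskering
    proof (rule less.hyps[OF small(1) del less.prems(2)])
      show "x = y" if "\<sigma> \<in> ?D" "k \<in> J" "{x, y} \<subseteq> \<sigma> \<inter> \<chi> k" for \<sigma> k x y
        using that less.prems(3) sub by blast
      show "vertex_decomposable (restriction (link ?D \<mu>) (V - ?W))"
        if \<mu>: "\<mu> \<in> ?D" "\<mu> \<subseteq> ?W" for \<mu>
      proof -
        have "w \<notin> \<mu>" using \<mu> unfolding deletion_def by blast
        \<comment> \<open>Faces inside \<open>V - ?W\<close> never contain \<open>w\<close>, so
          deleting \<open>w\<close> is invisible after restriction.\<close>
        then have "restriction (link ?D \<mu>) (V - ?W) = restriction (link \<Delta> \<mu>) (V - ?W)"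
          using j unfolding link_deletion[OF \<open>w \<notin> \<mu>\<close>]
          unfolding deletion_def restriction_def by blast
        then show ?thesis using less.prems(4) \<mu> sub by auto
      qed
    qed

    have VDlk: "vertex_decomposable (link (whiskering \<Delta> J \<chi>) {Inl w})"
      unfolding link_whiskering
    proof (rule less.hyps[OF small(2) lk])
      show "disjoint_family_on \<chi> ?J"
        using less.prems(2) unfolding disjoint_family_on_def by blast
      show "x = y" if "\<sigma> \<in> ?L" "k \<in> ?J" "{x, y} \<subseteq> \<sigma> \<inter> \<chi> k" for \<sigma> k x y
        using that less.prems(3) sub by blast
      show "vertex_decomposable (restriction (link ?L \<mu>) (V - (\<Union>k\<in>?J. \<chi> k)))"
        if \<mu>: "\<mu> \<in> ?L" "\<mu> \<subseteq> (\<Union>k\<in>?J. \<chi> k)" for \<mu>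
      proof -
        have w\<mu>: "{w} \<inter> \<mu> = {}" "{w} \<union> \<mu> \<in> \<Delta>" using \<mu>(1) unfolding link_def by auto
        have "\<sigma> \<inter> \<chi> j = {}" if "\<sigma> \<in> link ?L \<mu>" for \<sigma>
          using Lj that unfolding link_def[of ?L] by blast
        \<comment> \<open>Dropping colour \<open>j\<close> may enlarge the complement by points of
          \<open>\<chi> j\<close>, but no face of \<open>link ?L \<mu>\<close> contains such a
          point.\<close>
        then have "restriction (link ?L \<mu>) (V - (\<Union>k\<in>?J. \<chi> k)) = restriction (link ?L \<mu>) (V - ?W)"
          unfolding restriction_def J by blast
        also have "\<dots> = restriction (link \<Delta> ({w} \<union> \<mu>)) (V - ?W)"
          using link_link[OF cpx w\<mu>(1)] by simp
        \<comment> \<open>The hypothesis is applied to the larger face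
          \<open>{w} \<union> \<mu>\<close>, which still lies in \<open>?W\<close>.\<close>
        finally show ?thesis using less.prems(4)[OF w\<mu>(2)] \<mu>(2) j by auto
      qed
    qed

    have disj: "facets (whiskering ?D J \<chi>) \<inter> facets (whiskering ?L ?J \<chi>) = {}"
    proof -
      \<comment> \<open>It is enough that \<open>G\<close> is a face on the link side: such faces
        contain neither \<open>y_j\<close> nor a point of \<open>\<chi> j\<close>.\<close>
      have False if G: "G \<in> facets (whiskering ?D J \<chi>)" "G \<in> whiskering ?L ?J \<chi>" for G
      proof -
        obtain \<sigma> \<tau> where G': "G = Inl ` \<sigma> \<union> Inr ` \<tau>" by (rule Inl_Un_Inr_exhaust)
        have "j \<in> \<tau> \<or> \<sigma> \<inter> \<chi> j \<noteq> {}"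
          by (rule facet_of_whiskering_meets[OF G(1)[unfolded G'] j(1)])
        moreover have "\<sigma> \<in> ?L" "\<tau> \<subseteq> ?J"
          using G(2) unfolding G' Inl_Un_Inr_mem_whiskering_iff by auto
        ultimately show False using Lj j by blast
      qed
      then show ?thesis unfolding facets_def by blast
    qed
    have mem: "{Inl w} \<in> whiskering \<Delta> J \<chi>"
      using Inl_Un_Inr_mem_whiskering_iff[of "{w}" "{}" \<Delta> J \<chi>] w by simp
    show ?thesis
      by (rule vertex_decomposable.shed[OF mem VDdel VDlk])
        (simp only: deletion_whiskering link_whiskering disj)
  qed
qed

section \<open>Recovering the restricted links, and the equivalence\<close>

text \<open>The chosen face takes every \<open>y_j\<close> compatible with \<open>\<mu>\<close>, so
  each colour is occupied either by \<open>y_j\<close> or by a vertex of \<open>\<mu>\<close>. This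
  blocks all other new vertices and all coloured old vertices, and leaves the uncoloured ones
  unconstrained.\<close>

lemma link_whiskering_full_face:
  fixes \<Delta> :: "'a set set" and J :: "'b set"
  assumes "simplicial_complex V \<Delta>"
    and col: "\<And>\<sigma> j x y. \<sigma> \<in> \<Delta> \<Longrightarrow> j \<in> J \<Longrightarrow> {x, y} \<subseteq> \<sigma> \<inter> \<chi> j \<Longrightarrow> x = y"
    and "\<mu> \<in> \<Delta>"
  shows "link (whiskering \<Delta> J \<chi>) (Inl ` \<mu> \<union> Inr ` {j \<in> J. \<mu> \<inter> \<chi> j = {}}) =
    (`) Inl ` restriction (link \<Delta> \<mu>) (V - (\<Union>j\<in>J. \<chi> j))" (is "?A = ?B")
proof (rule set_of_sum_sets_eqI)
  fix \<sigma> :: "'a set" and \<tau> :: "'b set"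
  let ?T = "{j \<in> J. \<mu> \<inter> \<chi> j = {}}" and ?W = "\<Union>j\<in>J. \<chi> j"
  have "Inl ` \<sigma> \<union> Inr ` \<tau> \<in> ?B \<longleftrightarrow> \<tau> = {} \<and> \<sigma> \<in> restriction (link \<Delta> \<mu>) (V - ?W)"
    using Inl_Un_Inr_eq_iff[of \<sigma> \<tau> _ "{}"] by (auto simp add: image_iff)
  moreover have "Inl ` \<sigma> \<union> Inr ` \<tau> \<in> ?A \<longleftrightarrow> \<tau> = {} \<and> \<sigma> \<in> restriction (link \<Delta> \<mu>) (V - ?W)"
  proof
    assume "Inl ` \<sigma> \<union> Inr ` \<tau> \<in> ?A"
    then have *: "\<sigma> \<in> \<Delta>" "\<tau> \<subseteq> J" "\<mu> \<inter> \<sigma> = {}" "?T \<inter> \<tau> = {}" "\<mu> \<union> \<sigma> \<in> \<Delta>"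
      and avoid: "\<forall>j\<in>?T \<union> \<tau>. (\<mu> \<union> \<sigma>) \<inter> \<chi> j = {}"
      unfolding Inl_Un_Inr_mem_link_iff Inl_Un_Inr_mem_whiskering_iff by blast+
    \<comment> \<open>An index in \<open>\<tau>\<close> satisfies the condition defining
      \<open>?T\<close> by \<open>avoid\<close>, yet \<open>\<tau>\<close> is disjoint from
      \<open>?T\<close>.\<close>
    have "\<tau> = {}" using * avoid by blast
    have notin: "x \<notin> \<chi> j" if x: "x \<in> \<sigma>" and j: "j \<in> J" for x j
    proof
      assume "x \<in> \<chi> j"
      \<comment> \<open>Colours in \<open>?T\<close> are blocked by \<open>y_j\<close>; any other
        colour has a vertex in \<open>\<mu>\<close>, with which \<open>x\<close> would have to
        coincide.\<close>
      then have "j \<notin> ?T" using avoid x by blast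
      then obtain y where "y \<in> \<mu> \<inter> \<chi> j" using j by blast
      then have "x = y" using col[OF *(5) j] x \<open>x \<in> \<chi> j\<close> by blast
      with x \<open>y \<in> \<mu> \<inter> \<chi> j\<close> *(3) show False by blast
    qed
    have "\<sigma> \<in> link \<Delta> \<mu>" using * unfolding link_def by simp
    moreover have "\<sigma> \<subseteq> V - ?W"
      using simplicial_complexD(4)[OF assms(1) *(1)] notin by blast
    ultimately show "\<tau> = {} \<and> \<sigma> \<in> restriction (link \<Delta> \<mu>) (V - ?W)"
      using \<open>\<tau> = {}\<close> unfolding restriction_def by simp
  next
    assume "\<tau> = {} \<and> \<sigma> \<in> restriction (link \<Delta> \<mu>) (V - ?W)"
    then have *: "\<tau> = {}" "\<sigma> \<in> \<Delta>" "\<mu> \<inter> \<sigma> = {}" "\<mu> \<union> \<sigma> \<in> \<Delta>" and "\<sigma> \<inter> ?W = {}"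
      unfolding restriction_def link_def by auto
    then have "\<forall>j\<in>?T. (\<mu> \<union> \<sigma>) \<inter> \<chi> j = {}" by blast
    with * show "Inl ` \<sigma> \<union> Inr ` \<tau> \<in> ?A"
      unfolding Inl_Un_Inr_mem_link_iff Inl_Un_Inr_mem_whiskering_iff by simp
  qed
  ultimately show "Inl ` \<sigma> \<union> Inr ` \<tau> \<in> ?A \<longleftrightarrow> Inl ` \<sigma> \<union> Inr ` \<tau> \<in> ?B" by blast
qed

text \<open>Turns the bound on facets of the restriction into a condition on every face of
  \<open>\<Delta>\<close>: since \<open>\<chi> j \<subseteq> W\<close>, only
  \<open>\<sigma> \<inter> W\<close> matters, and it lies in a facet of the restriction.\<close>

lemma coloring_face_eq:
  assumes "simplicial_complex V \<Delta>" "coloring s W (restriction \<Delta> W) \<chi>"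
    and "\<sigma> \<in> \<Delta>" "j \<in> {1..s}" "{x, y} \<subseteq> \<sigma> \<inter> \<chi> j"
  shows "x = y"
proof -
  have W: "\<chi> j \<subseteq> W" using assms(2,4) unfolding coloring_def by blast
  have "\<sigma> \<inter> W \<in> restriction \<Delta> W"
    using simplicial_complexD(3)[OF assms(1,3)] unfolding restriction_def by simp
  moreover have "finite (restriction \<Delta> W)"
    using simplicial_complexD(1)[OF assms(1)] unfolding restriction_def by simp
  ultimately obtain F where F: "F \<in> facets (restriction \<Delta> W)" "\<sigma> \<inter> W \<subseteq> F"
    using exists_facet_above by metis
  have "F \<subseteq> V"
    using F(1) simplicial_complexD(4)[OF assms(1)] unfolding facets_def restriction_def by blast
  \<comment> \<open>Finiteness makes the bound meaningful, since \<open>card\<close> of an infinite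
    set is 0.\<close>
  then have "finite (F \<inter> \<chi> j)"
    using assms(1) rev_finite_subset[of V F] unfolding simplicial_complex_def by simp
  moreover have "card (F \<inter> \<chi> j) \<le> 1" using assms(2,4) F(1) unfolding coloring_def by blast
  moreover have "{x, y} \<subseteq> F \<inter> \<chi> j" using assms(5) F(2) W by blast
  ultimately show ?thesis using card_le_Suc0_iff_eq[of "F \<inter> \<chi> j"] by auto
qed

theorem theorem1p1:
  fixes V W :: "'a set" and \<Delta> :: "'a set set" and s :: nat and \<chi> :: "nat \<Rightarrow> 'a set"
  assumes "simplicial_complex V \<Delta>"
    and "W \<subseteq> V"
    and "coloring s W (restriction \<Delta> W) \<chi>"
  shows "vertex_decomposable (whiskered \<Delta> s \<chi>) \<longleftrightarrow>
    (\<forall>\<mu>\<in>\<Delta>. \<mu> \<subseteq> W \<longrightarrow> vertex_decomposable (restriction (link \<Delta> \<mu>) (V - W)))"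
proof -
  let ?X = "whiskering \<Delta> {1..s} \<chi>"
  have W: "W = (\<Union>j\<in>{1..s}. \<chi> j)" and disj: "disjoint_family_on \<chi> {1..s}"
    using assms(3) unfolding coloring_def by auto
  note col = coloring_face_eq[OF assms(1,3)]
  show ?thesis
    unfolding whiskered_eq
  proof (intro iffI ballI impI)
    fix \<mu> assume VD: "vertex_decomposable ?X" and \<mu>: "\<mu> \<in> \<Delta>" "\<mu> \<subseteq> W"
    \<comment> \<open>The face over \<open>\<mu>\<close> containing all admissible new
      vertices.\<close>
    let ?F = "Inl ` \<mu> \<union> Inr ` {j \<in> {1..s}. \<mu> \<inter> \<chi> j = {}}"
    have "?F \<in> ?X" unfolding Inl_Un_Inr_mem_whiskering_iff using \<mu> by blast
    then have "vertex_decomposable (link ?X ?F)"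
      by (rule vertex_decomposable_link[OF VD
            simplicial_complex_whiskering[OF assms(1) finite_atLeastAtMost]])
    moreover have "link ?X ?F = (`) Inl ` restriction (link \<Delta> \<mu>) (V - W)"
      unfolding W by (rule link_whiskering_full_face[OF assms(1) _ \<mu>(1)]) (rule col)
    ultimately have
      "vertex_decomposable ((`) Inl ` restriction (link \<Delta> \<mu>) (V - W) :: ('a + nat) set set)"
      by (simp only:)
    then show "vertex_decomposable (restriction (link \<Delta> \<mu>) (V - W))"
      by (rule vertex_decomposable_image_imp[OF inj_Inl])
  next
    assume VD: "\<forall>\<mu>\<in>\<Delta>. \<mu> \<subseteq> W \<longrightarrow> vertex_decomposable (restriction (link \<Delta> \<mu>) (V - W))"
    show "vertex_decomposable ?X"
    proof (rule vertex_decomposable_whiskering[OF assms(1) disj])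
      show "x = y" if "\<sigma> \<in> \<Delta>" "j \<in> {1..s}" "{x, y} \<subseteq> \<sigma> \<inter> \<chi> j" for \<sigma> j x y
        using that by (rule col)
    qed (use VD in \<open>simp add: W\<close>)
  qed
qed

end
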